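(* Let $r,n$ be natural numbers and let $G$ be an Abelian group (written additively) with $|G|\ge r^2 n$. Then for every $r$-coloring $\chi:G\to\{1,\dots,r\}$ there exists a subset $A\subset G$ such that $A$ is monochromatic (i.e. $\chi$ is constant on $A$), $A$ is symmetric (i.e. $A=2g-A=\{2g-a:a\in A\}$ for some $g\in G$), and $|A|\ge n$.
   Context: An $r$-coloring of a set is a map from it to an $r$-element set of colors. A subset $A$ of an Abelian group $G$ is called symmetric if $A=2g-A$ for some $g\in G$ (in multiplicative notation, $A=gA^{-1}g$). *)

theory Defs
  imports Main
begin

definition monochromatic :: "('a \<Rightarrow> 'c) \<Rightarrow> 'a set \<Rightarrow> bool" where
  "monochromatic col A \<longleftrightarrow> (\<exists>c. \<forall>a\<in>A. col a = c)"

definition symmetric_set :: "'a::ab_group_add set \<Rightarrow> bool" where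
  "symmetric_set A \<longleftrightarrow> (\<exists>g. A = {(g + g) - a | a. a \<in> A})"

text \<open>\<open>card\<close> is \<open>0\<close> on infinite sets, so the cardinality bound \<open>|A| \<ge> k\<close> needs a separate disjunct.\<close>

definition card_at_least :: "nat \<Rightarrow> 'a set \<Rightarrow> bool" where
  "card_at_least k A \<longleftrightarrow> infinite A \<or> k \<le> card A"

end

theory Submission
  imports Defs "HOL-Library.FuncSet"
begin

text \<open>
  Count the triples \<open>(x, u, v) \<in> X \<times> U \<times> U\<close> for which \<open>x + 2u\<close> and \<open>x + 2v\<close> have the same colour.
  By Cauchy--Schwarz there are at least \<open>|X| |U|\<^sup>2 / r\<close> of them. The two points \<open>x + 2u\<close> and \<open>x + 2v\<close>
  are symmetric about \<open>x + u + v\<close>; so if these centres lie in a set \<open>Y\<close>, pigeonholing over centres and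
  colours gives a monochromatic symmetric set of size at least \<open>|X| |U| / (r\<^sup>2 |Y|)\<close>.
  For finite \<open>G\<close> take \<open>X = Y = U = G\<close>. For infinite \<open>G\<close> take \<open>U\<close> finite but large; since an Abelian
  group has polynomial growth, there is \<open>X\<close> with \<open>|X + U + U| \<le> 2 |X|\<close>.
\<close>

text \<open>The intersection of colour class \<open>c\<close> with its mirror image about
  \<open>g\<close>: the largest set of colour \<open>c\<close> symmetric about
  \<open>g\<close>.\<close>

definition symmetric_part :: "('a::ab_group_add \<Rightarrow> nat) \<Rightarrow> 'a \<Rightarrow> nat \<Rightarrow> 'a set" where
  "symmetric_part col g c = {x. col x = c \<and> col (g + g - x) = c}"

lemma monochromatic_symmetric_part: "monochromatic col (symmetric_part col g c)"
  by (auto simp: monochromatic_def symmetric_part_def)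

lemma symmetric_symmetric_part: "symmetric_set (symmetric_part col g c)"
proof -
  have "symmetric_part col g c = {(g + g) - a | a. a \<in> symmetric_part col g c}"
  proof (intro set_eqI iffI)
    fix x assume "x \<in> symmetric_part col g c"
    then show "x \<in> {(g + g) - a | a. a \<in> symmetric_part col g c}"
      by (intro CollectI exI[of _ "g + g - x"]) (auto simp: symmetric_part_def)
  qed (auto simp: symmetric_part_def)
  then show ?thesis unfolding symmetric_set_def by blast
qed

text \<open>Cauchy-Schwarz as nonnegativity of a variance: with \<open>S\<close> the total and
  \<open>r\<close> the size of \<open>C\<close>, expand the sum of \<open>(r * f c - S)^2\<close>.
  Scaling by \<open>r\<close> avoids dividing to form the mean; working in the integers makes the
  subtraction genuine.\<close>

lemma square_sum_le_card_times_sum_squares: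
  fixes f :: "'b \<Rightarrow> nat"
  assumes "finite C"
  shows "(\<Sum>c\<in>C. f c)\<^sup>2 \<le> card C * (\<Sum>c\<in>C. (f c)\<^sup>2)"
proof (cases "C = {}")
  case False
  define S Q r where "S = (\<Sum>c\<in>C. int (f c))" and "Q = (\<Sum>c\<in>C. (int (f c))\<^sup>2)" and "r = int (card C)"
  have "r > 0" using False assms by (simp add: r_def card_gt_0_iff)
  have "0 \<le> (\<Sum>c\<in>C. (r * int (f c) - S)\<^sup>2)" by (simp add: sum_nonneg)
  also have "\<dots> = (\<Sum>c\<in>C. r\<^sup>2 * (int (f c))\<^sup>2 - 2 * r * S * int (f c) + S\<^sup>2)"
    by (intro sum.cong) (auto simp: power2_eq_square algebra_simps)
  also have "\<dots> = r\<^sup>2 * Q - 2 * r * S * S + r * S\<^sup>2"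
    by (simp add: sum.distrib sum_subtractf S_def Q_def r_def flip: sum_distrib_left)
  also have "\<dots> = r * (r * Q - S\<^sup>2)" by (simp add: power2_eq_square algebra_simps)
  finally have "S\<^sup>2 \<le> r * Q" using \<open>r > 0\<close> by (simp add: zero_le_mult_iff)
  then have "int ((\<Sum>c\<in>C. f c)\<^sup>2) \<le> int (card C * (\<Sum>c\<in>C. (f c)\<^sup>2))"
    by (simp add: S_def Q_def r_def)
  then show ?thesis by (simp only: of_nat_le_iff)
qed simp

text \<open>The equal-coloured pairs form the disjoint union of the squares of the colour classes of
  \<open>U\<close>, so Cauchy-Schwarz applies to the class sizes.\<close>

lemma card_square_le_colour_pairs:
  fixes f :: "'b \<Rightarrow> nat"
  assumes "finite U" "f ` U \<subseteq> {1..r}"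
  shows "(card U)\<^sup>2 \<le> r * card {(u, v). u \<in> U \<and> v \<in> U \<and> f u = f v}"
proof -
  define W where "W c = {u \<in> U. f u = c}" for c
  have fin: "finite (W c)" for c using assms by (simp add: W_def)
  have "U = (\<Union>c\<in>{1..r}. W c)" using assms(2) by (auto simp: W_def)
  then have "card U = card (\<Union>c\<in>{1..r}. W c)" by simp
  also have "\<dots> = (\<Sum>c\<in>{1..r}. card (W c))"
    by (rule card_UN_disjoint) (use fin in \<open>auto simp: W_def\<close>)
  finally have U: "card U = (\<Sum>c\<in>{1..r}. card (W c))" .
  have "{(u, v). u \<in> U \<and> v \<in> U \<and> f u = f v} = (\<Union>c\<in>{1..r}. W c \<times> W c)"
    using assms(2) by (fastforce simp: W_def)
  then have "card {(u, v). u \<in> U \<and> v \<in> U \<and> f u = f v} = card (\<Union>c\<in>{1..r}. W c \<times> W c)" by simp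
  also have "\<dots> = (\<Sum>c\<in>{1..r}. card (W c \<times> W c))"
    by (rule card_UN_disjoint) (use fin in \<open>auto simp: W_def\<close>)
  also have "\<dots> = (\<Sum>c\<in>{1..r}. (card (W c))\<^sup>2)"
    by (simp add: card_cartesian_product power2_eq_square)
  finally show ?thesis
    using square_sum_le_card_times_sum_squares[of "{1..r}" "\<lambda>c. card (W c)"] U by simp
qed

lemma card_mult_le_of_symmetric_parts_bounded:
  fixes col :: "'a::ab_group_add \<Rightarrow> nat" and X U Y :: "'a set"
  assumes fin: "finite X" "finite U" "finite Y" and "U \<noteq> {}"
    and centre: "\<And>x u v. x \<in> X \<Longrightarrow> u \<in> U \<Longrightarrow> v \<in> U \<Longrightarrow> x + u + v \<in> Y"
    and col: "\<forall>x. col x \<in> {1..r}"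
    and bound: "\<And>g c. finite (symmetric_part col g c) \<and> card (symmetric_part col g c) \<le> M"
  shows "card X * card U \<le> r\<^sup>2 * card Y * M"
proof -
  define P where "P x = {(u, v). u \<in> U \<and> v \<in> U \<and> col (x + u + u) = col (x + v + v)}" for x
  define T where "T = Sigma X P"
  \<comment> \<open>The target of the count: a centre, a colour, a point of the corresponding
    symmetric part, and one spare element of \<open>U\<close> that makes the encoding below
    injective.\<close>
  define R where "R = Sigma (Y \<times> {1..r}) (\<lambda>(g, c). symmetric_part col g c \<times> U)"
  have finP: "finite (P x)" for x
    by (rule finite_subset[of _ "U \<times> U"]) (use fin in \<open>auto simp: P_def\<close>)
  have finR: "finite R" unfolding R_def
    by (intro finite_SigmaI) (use fin bound in auto)
  \<comment> \<open>Knowing \<open>v\<close>, the centre yields \<open>x + u\<close>; subtracting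
    that from \<open>x + u + u\<close> yields \<open>u\<close>, and then \<open>x\<close>. Nothing
    is halved, so elements of order 2 do no harm.\<close>
  define \<phi> where "\<phi> = (\<lambda>(x, u, v). ((x + u + v, col (x + u + u)), (x + u + u, v)))"
  have "inj_on \<phi> T"
  proof (rule inj_onI)
    fix p q assume eq: "\<phi> p = \<phi> q"
    obtain x u v x' u' v' where pq: "p = (x, u, v)" "q = (x', u', v')" by (metis prod.exhaust)
    have "v = v'" "x + u = x' + u'" "x + u + u = x' + u' + u'"
      using eq by (auto simp: \<phi>_def pq)
    then show "p = q" by (simp add: pq)
  qed
  moreover have "\<phi> ` T \<subseteq> R"
  proof clarsimp
    fix x u v assume "(x, u, v) \<in> T"
    then have *: "x \<in> X" "u \<in> U" "v \<in> U" "col (x + u + u) = col (x + v + v)"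
      by (auto simp: T_def P_def)
    have "x + u + v + (x + u + v) - (x + u + u) = x + v + v" by (simp add: algebra_simps)
    then show "\<phi> (x, u, v) \<in> R"
      using * centre col by (auto simp: \<phi>_def R_def symmetric_part_def)
  qed
  ultimately have "card T \<le> card R" using finR by (rule card_inj_on_le)
  also have "\<dots> = (\<Sum>(g, c)\<in>Y \<times> {1..r}. card (symmetric_part col g c) * card U)"
    unfolding R_def using fin bound
    by (subst card_SigmaI) (auto simp: card_cartesian_product intro!: sum.cong)
  also have "\<dots> \<le> (\<Sum>(g, c)\<in>Y \<times> {1..r}. M * card U)"
    by (intro sum_mono) (use bound in auto)
  also have "\<dots> = card Y * r * (M * card U)" by (simp add: case_prod_beta card_cartesian_product)
  finally have upper: "card T \<le> card Y * r * (M * card U)" .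
  have "card X * (card U)\<^sup>2 = (\<Sum>x\<in>X. (card U)\<^sup>2)" by simp
  also have "\<dots> \<le> (\<Sum>x\<in>X. r * card (P x))"
    unfolding P_def by (intro sum_mono card_square_le_colour_pairs) (use fin col in auto)
  also have "\<dots> = r * card T"
    using fin finP by (simp add: T_def card_SigmaI flip: sum_distrib_left)
  also have "\<dots> \<le> r * (card Y * r * (M * card U))" using upper by simp
  \<comment> \<open>The spare coordinate in \<open>R\<close> costs a factor \<open>card U\<close> on
    the right, which cancels because \<open>U\<close> is nonempty.\<close>
  finally have "card U * (card X * card U) \<le> card U * (r\<^sup>2 * card Y * M)"
    by (simp add: power2_eq_square ac_simps)
  moreover have "card U > 0" using fin \<open>U \<noteq> {}\<close> by (simp add: card_gt_0_iff)
  ultimately show ?thesis by simp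
qed

text \<open>With \<open>j = 2 ^ m\<close> both sides are compared through powers of 2, and it
  remains to have \<open>(m + 2) * d < 2 ^ m\<close>.\<close>

lemma exists_polynomial_less_exponential:
  "\<exists>j::nat. (2 * j + 1) ^ d < 2 ^ j"
proof -
  \<comment> \<open>This makes \<open>2 ^ m\<close> the square of \<open>2 * 2 ^ d\<close>, while
    \<open>(m + 2) * d\<close> is below the square of \<open>2 * (d + 1)\<close>; so
    \<open>d + 1 \<le> 2 ^ d\<close> suffices.\<close>
  define m where "m = 2 * d + 2"
  have d: "Suc d \<le> 2 ^ d" using less_exp[of d] by (simp only: Suc_le_eq)
  have "(m + 2) * d < (2 * Suc d) * (2 * Suc d)" by (simp add: m_def algebra_simps)
  also have "\<dots> \<le> (2 * 2 ^ d) * (2 * 2 ^ d)" using d by (intro mult_mono) auto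
  also have "\<dots> = 2 ^ m" by (simp add: m_def power_add power_even_eq power2_eq_square)
  finally have md: "(m + 2) * d < 2 ^ m" .
  have "2 * 2 ^ m + 1 \<le> (2::nat) ^ (m + 2)" by simp
  then have "(2 * 2 ^ m + 1) ^ d \<le> ((2::nat) ^ (m + 2)) ^ d" by (rule power_mono) simp
  also have "\<dots> = 2 ^ ((m + 2) * d)" by (simp only: power_mult)
  also have "\<dots> < 2 ^ (2 ^ m)" using md by (intro power_strict_increasing) auto
  finally show ?thesis by blast
qed

text \<open>Let \<open>B k\<close> consist of the combinations of \<open>U\<close> with coefficients
  at most \<open>k\<close>. Commutativity bounds its size by \<open>(k + 1) ^ card U\<close>, so its
  size cannot more than double at every step from \<open>2 * j\<close> to \<open>2 * j + 2\<close>.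
  The step is 2 because two elements of \<open>U\<close> are added.\<close>

lemma exists_small_doubling_set:
  fixes U :: "'a::ab_group_add set"
  assumes "finite U"
  obtains X Y where "finite X" "X \<noteq> {}" "finite Y" "card Y \<le> 2 * card X"
    "\<And>x u v. x \<in> X \<Longrightarrow> u \<in> U \<Longrightarrow> v \<in> U \<Longrightarrow> x + u + v \<in> Y"
proof -
  \<comment> \<open>Type class \<open>ab_group_add\<close> has no natural multiples; \<open>\<Sum>i<k. u\<close> stands for \<open>k\<close> times \<open>u\<close>.\<close>
  define f where "f a = (\<Sum>u\<in>U. \<Sum>i<a u. u)" for a :: "'a \<Rightarrow> nat"
  define B where "B k = f ` (U \<rightarrow>\<^sub>E {..k})" for k
  have finB: "finite (B k)" for k using assms by (simp add: B_def finite_PiE)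
  have neB: "B k \<noteq> {}" for k by (auto simp: B_def PiE_eq_empty_iff)
  have cardB: "card (B k) \<le> (k + 1) ^ card U" for k
    using card_image_le[of "U \<rightarrow>\<^sub>E {..k}" f] assms by (simp add: B_def finite_PiE card_PiE)
  have step: "x + u \<in> B (Suc k)" if x: "x \<in> B k" and u: "u \<in> U" for x u k
  proof -
    obtain a where a: "a \<in> U \<rightarrow>\<^sub>E {..k}" "x = f a" using x unfolding B_def by blast
    have "f (a(u := Suc (a u))) = f a + u"
      unfolding f_def using assms u
      by (simp add: sum.remove[of U u] algebra_simps)
    moreover have "a(u := Suc (a u)) \<in> U \<rightarrow>\<^sub>E {..Suc k}"
      using a(1) u by (fastforce simp: PiE_iff extensional_def)
    ultimately show ?thesis unfolding B_def a(2) by (metis imageI)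
  qed
  have "\<exists>j. card (B (2 * Suc j)) \<le> 2 * card (B (2 * j))"
  proof (rule ccontr)
    assume "\<not> ?thesis"
    then have grow: "2 * card (B (2 * j)) < card (B (2 * Suc j))" for j by (auto simp: not_le)
    have "2 ^ j \<le> card (B (2 * j))" for j
    proof (induction j)
      case 0
      then show ?case using finB neB by (simp add: Suc_le_eq card_gt_0_iff)
    next
      case (Suc j)
      then show ?case using grow[of j] by simp
    qed
    then have "2 ^ j \<le> (2 * j + 1) ^ card U" for j using cardB le_trans by blast
    then show False using exists_polynomial_less_exponential[of "card U"] by (meson not_le)
  qed
  then obtain j where j: "card (B (2 * Suc j)) \<le> 2 * card (B (2 * j))" ..
  show thesis
    by (rule that[of "B (2 * j)" "B (2 * Suc j)"]) (use finB neB j step in auto)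
qed

theorem theorem1p4:
  fixes r n :: nat and col :: "'a::ab_group_add \<Rightarrow> nat"
  assumes "card_at_least (r\<^sup>2 * n) (UNIV :: 'a set)"
    and "\<forall>x. col x \<in> {1..r}"
  shows "\<exists>A :: 'a set. monochromatic col A \<and> symmetric_set A \<and> card_at_least n A"
proof (rule ccontr)
  assume "\<not> ?thesis"
  then have "\<not> card_at_least n (symmetric_part col g c)" for g c
    using monochromatic_symmetric_part symmetric_symmetric_part by blast
  then have small: "finite (symmetric_part col g c) \<and> card (symmetric_part col g c) < n" for g c
    by (simp add: card_at_least_def not_le)
  then have n: "n > 0" using gr_zeroI by fastforce
  \<comment> \<open>The counting bound is used with \<open>M = n - 1\<close>; since \<open>r\<close>
    and \<open>n\<close> are positive, this makes it strictly smaller than with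
    \<open>n\<close>.\<close>
  have bound: "finite (symmetric_part col g c) \<and> card (symmetric_part col g c) \<le> n - 1" for g c
    using small[of g c] by auto
  have "r > 0" using assms(2) by (auto dest: spec[of _ 0])
  then have strict: "r\<^sup>2 * (n - 1) < r\<^sup>2 * n" using n by simp
  show False
  proof (cases "finite (UNIV :: 'a set)")
    case True
    \<comment> \<open>Here \<open>X\<close>, \<open>U\<close> and \<open>Y\<close> are all the whole
      group, and one factor of its order cancels.\<close>
    then have "card (UNIV :: 'a set) * card (UNIV :: 'a set) \<le> r\<^sup>2 * card (UNIV :: 'a set) * (n - 1)"
      by (intro card_mult_le_of_symmetric_parts_bounded[OF _ _ _ _ _ assms(2) bound]) auto
    moreover have "card (UNIV :: 'a set) > 0" using True by (simp add: card_gt_0_iff)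
    ultimately have "card (UNIV :: 'a set) \<le> r\<^sup>2 * (n - 1)"
      by (simp add: mult.commute mult.left_commute)
    moreover have "r\<^sup>2 * n \<le> card (UNIV :: 'a set)" using assms(1) True by (simp add: card_at_least_def)
    ultimately show False using strict by linarith
  next
    case False
    \<comment> \<open>The factor 2 in the size of \<open>U\<close> absorbs the loss from
      \<open>card Y \<le> 2 * card X\<close>.\<close>
    then obtain U :: "'a set" where U: "finite U" "card U = 2 * (r\<^sup>2 * n)"
      using infinite_arbitrarily_large by blast
    then have "U \<noteq> {}" using \<open>r > 0\<close> n by auto
    obtain X Y where XY: "finite X" "X \<noteq> {}" "finite Y" "card Y \<le> 2 * card X"
      "\<And>x u v. x \<in> X \<Longrightarrow> u \<in> U \<Longrightarrow> v \<in> U \<Longrightarrow> x + u + v \<in> Y"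
      using exists_small_doubling_set[OF U(1)] by blast
    have "card X * card U \<le> r\<^sup>2 * card Y * (n - 1)"
      using XY U \<open>U \<noteq> {}\<close>
      by (intro card_mult_le_of_symmetric_parts_bounded[OF _ _ _ _ _ assms(2) bound]) auto
    also have "\<dots> \<le> r\<^sup>2 * (2 * card X) * (n - 1)" using XY(4) by simp
    also have "\<dots> = 2 * card X * (r\<^sup>2 * (n - 1))" by (simp only: ac_simps)
    also have "\<dots> < 2 * card X * (r\<^sup>2 * n)"
      using strict XY by (intro mult_strict_left_mono) (auto simp: card_gt_0_iff)
    also have "\<dots> = card X * card U" using U by simp
    finally show False by simp
  qed
qed

end
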